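(* Let $\mathbb{K}$ be a field of characteristic zero, let $g_1(t),g_2(t)$ be invertible series and $f_1(t),f_2(t)$ delta series over $\mathbb{K}$, let $(s_n^{(1)}(x))_{n\ge 0}$ be the Sheffer sequence for $(g_1(t),f_1(t))$ and $(s_n^{(2)}(x))_{n\ge0}$ the Sheffer sequence for $(g_2(t),f_2(t))$, and let $(s_n^{[2]}(x))_{n\ge0}$ be the associated 2-iterated Sheffer polynomials, i.e. $s_n^{[2]}(x)$ is obtained from $s_n^{(1)}(x)$ by replacing each power $x^k$ by $s_k^{(2)}(x)$. Then $$\frac{1}{g_1(\bar f_1(t))}\,\frac{1}{g_2(\bar f_2(\bar f_1(t)))}\exp\bigl(x\,\bar f_2(\bar f_1(t))\bigr)=\sum_{n=0}^\infty s_n^{[2]}(x)\frac{t^n}{n!}.$$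
   Context: A formal power series $g(t)=\sum_{n\ge0} g_n t^n/n!$ over $\mathbb{K}$ is invertible if $g_0\ne0$. A formal power series $f(t)=\sum_{n\ge0}f_nt^n/n!$ is a delta series if $f_0=0$ and $f_1\neq 0$; then $\bar f(t)$ denotes its compositional inverse, $f(\bar f(t))=\bar f(f(t))=t$. The Sheffer sequence $(s_n(x))_{n\ge0}$ for $(g(t),f(t))$ is the polynomial sequence determined by $$\frac{1}{g(\bar f(t))}e^{x\bar f(t)}=\sum_{n=0}^\infty s_n(x)\frac{t^n}{n!}.$$ If $s_n^{(1)}(x)=\sum_{k=0}^n b_{n,k}x^k$, the 2-iterated Sheffer polynomials are $s_n^{[2]}(x)=\sum_{k=0}^n b_{n,k}s_k^{(2)}(x)$. *)

theory Defs
  imports "HOL-Computational_Algebra.Computational_Algebra"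
begin

text \<open>
  The paper writes series over a field of characteristic zero as
  \<open>\<Sum>n. g_n t^n / n!\<close>. Since \<open>0! = 1! = 1\<close>, the numbers \<open>g_0\<close> and \<open>g_1\<close> are also the
  ordinary coefficients returned by \<^const>\<open>fps_nth\<close>. The compositional inverse of a
  delta series is \<^const>\<open>fps_inv\<close>.
\<close>

definition invertible_series :: "'a::field_char_0 fps \<Rightarrow> bool" where
  "invertible_series g \<longleftrightarrow> fps_nth g 0 \<noteq> 0"

definition delta_series :: "'a::field_char_0 fps \<Rightarrow> bool" where
  "delta_series f \<longleftrightarrow> fps_nth f 0 = 0 \<and> fps_nth f 1 \<noteq> 0"

text \<open>
  Generating functions of polynomial sequences live in \<open>K[x][[t]]\<close>, represented by the
  type \<open>'a poly fps\<close>: \<open>x\<close> is the polynomial \<open>[:0, 1:]\<close> and \<open>t\<close> is the power series variable.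
  The following is the inclusion of \<open>K[[t]]\<close> into \<open>K[x][[t]]\<close>.
\<close>

definition fps_lift :: "'a::field_char_0 fps \<Rightarrow> 'a poly fps" where
  "fps_lift F = Abs_fps (\<lambda>n. [:fps_nth F n:])"

text \<open>
  \<open>exp (x h(t))\<close>: the series \<open>x h(t)\<close> is substituted into the exponential series. As
  always for \<^const>\<open>fps_compose\<close>, this is meaningful when \<open>h\<close> has constant term 0. The
  library's \<^const>\<open>fps_exp\<close> needs coefficients in a field, hence the detour through
  \<open>K[[t]]\<close>.
\<close>

definition exp_x_times :: "'a::field_char_0 fps \<Rightarrow> 'a poly fps" where
  "exp_x_times h = fps_lift (fps_exp 1) oo (fps_const [:0, 1:] * fps_lift h)"

definition egf :: "(nat \<Rightarrow> 'a::field_char_0 poly) \<Rightarrow> 'a poly fps" where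
  "egf s = Abs_fps (\<lambda>n. smult (1 / fact n) (s n))"

definition sheffer_sequence ::
    "'a::field_char_0 fps \<Rightarrow> 'a fps \<Rightarrow> (nat \<Rightarrow> 'a poly) \<Rightarrow> bool" where
  "sheffer_sequence g f s \<longleftrightarrow>
     fps_lift (inverse (g oo fps_inv f)) * exp_x_times (fps_inv f) = egf s"

definition iterated_sheffer ::
    "(nat \<Rightarrow> 'a::field_char_0 poly) \<Rightarrow> (nat \<Rightarrow> 'a poly) \<Rightarrow> nat \<Rightarrow> 'a poly" where
  "iterated_sheffer s1 s2 n = (\<Sum>k=0..n. smult (coeff (s1 n) k) (s2 k))"

lemma ex1_sheffer_sequence: "\<exists>!s. sheffer_sequence g f s"
proof -
  have *: "F = egf s \<longleftrightarrow> s = (\<lambda>n. smult (fact n) (fps_nth F n))" for F s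
    by (auto simp: egf_def fps_eq_iff fun_eq_iff)
  show ?thesis
    unfolding sheffer_sequence_def * by blast
qed

end

theory Submission
  imports Defs
begin

text \<open>
  Write \<open>h\<close> for the compositional inverse of \<open>f1\<close> and \<open>A\<close> for \<open>1 / g1(h(t))\<close>. Comparing
  powers of \<open>x\<close> in the generating function \<open>A(t) exp (x h(t))\<close> of \<open>s1\<close> shows that the
  connection coefficients are given by a Riordan array:
  \<open>coeff (s1 n) k / n! = [t^n] (A(t) h(t)^k) / k!\<close>.
  Replacing each \<open>x^k\<close> by \<open>s2 k\<close> therefore turns
  \<open>A(t) exp (x h(t)) = A(t) (\<Sum>k. x^k h(t)^k / k!)\<close> into \<open>A(t) (\<Sum>k. s2 k h(t)^k / k!)\<close>, which
  is \<open>A(t)\<close> times the generating function of \<open>s2\<close> evaluated at \<open>h(t)\<close>; this is lemma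
  \<open>egf_iterated_sheffer\<close>. Since the generating function of \<open>s2\<close> is a product of a series
  in \<open>t\<close> and an exponential, and composition with \<open>h\<close> is multiplicative and associative,
  the evaluation merely replaces \<open>t\<close> by \<open>h(t)\<close> in both factors.
\<close>

lemma fps_lift_nth [simp]: "fps_nth (fps_lift F) n = [:fps_nth F n:]"
  by (simp add: fps_lift_def)

lemma egf_nth [simp]: "fps_nth (egf s) n = smult (1 / fact n) (s n)"
  by (simp add: egf_def)

lemma smult_sum_right: "smult a (\<Sum>i\<in>I. p i) = (\<Sum>i\<in>I. smult a (p i))"
  by (induction I rule: infinite_finite_induct) (simp_all add: smult_add_right)

lemma fps_lift_mult: "fps_lift (F * G) = fps_lift F * fps_lift G"
  by (rule fps_ext) (simp add: fps_mult_nth mult.commute flip: sum_to_poly)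

lemma fps_lift_power: "fps_lift (F ^ k) = fps_lift F ^ k"
proof (induction k)
  case 0
  show ?case by (rule fps_ext) (simp add: one_pCons)
next
  case (Suc k)
  then show ?case by (simp add: fps_lift_mult)
qed

lemma fps_lift_compose: "fps_lift (F oo G) = fps_lift F oo fps_lift G"
  by (rule fps_ext) (simp add: fps_compose_nth mult.commute flip: sum_to_poly fps_lift_power)

text \<open>
  Moving the factor \<open>x\<close> from the inner series to the coefficients of the outer one makes
  the exponential an instance of the series that \<open>fps_lift_mult_compose_nth\<close> treats.
\<close>

lemma exp_x_times_eq_egf_compose:
  "exp_x_times h = egf (\<lambda>k. [:0, 1:] ^ k) oo fps_lift h"
  by (rule fps_ext)
    (simp add: exp_x_times_def fps_compose_nth power_mult_distrib mult.assoc)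

lemma exp_x_times_compose:
  assumes "fps_nth F 0 = 0" and "fps_nth h 0 = 0"
  shows "exp_x_times (F oo h) = exp_x_times F oo fps_lift h"
  using assms by (simp add: exp_x_times_eq_egf_compose fps_lift_compose fps_compose_assoc)

text \<open>
  Entry \<open>(n, k)\<close> of the Riordan array of \<open>(A, h)\<close> is \<open>[t^n] (A h^k)\<close>. As \<open>h\<close> has no constant
  term, \<open>h^k\<close> starts at \<open>t^k\<close>, so the array is lower triangular and the sum stops at \<open>n\<close>.
\<close>

lemma fps_lift_mult_compose_nth:
  assumes h0: "fps_nth h 0 = 0"
  shows "fps_nth (fps_lift A * (G oo fps_lift h)) n
       = (\<Sum>k=0..n. smult (fps_nth (A * h ^ k) n) (fps_nth G k))"
proof -
  have compose_nth: "fps_nth (G oo fps_lift h) m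
      = (\<Sum>k=0..n. smult (fps_nth (h ^ k) m) (fps_nth G k))" if "m \<le> n" for m
  proof -
    have "fps_nth (G oo fps_lift h) m
        = (\<Sum>k=0..m. smult (fps_nth (h ^ k) m) (fps_nth G k))"
      by (simp add: fps_compose_nth flip: fps_lift_power)
    also have "\<dots> = (\<Sum>k=0..n. smult (fps_nth (h ^ k) m) (fps_nth G k))"
      using that h0 by (intro sum.mono_neutral_left) (auto simp: startsby_zero_power_prefix)
    finally show ?thesis .
  qed
  have "fps_nth (fps_lift A * (G oo fps_lift h)) n
      = (\<Sum>i=0..n. \<Sum>k=0..n. smult (fps_nth A i * fps_nth (h ^ k) (n - i)) (fps_nth G k))"
    by (simp add: fps_mult_nth compose_nth smult_sum_right)
  also have "\<dots> = (\<Sum>k=0..n. smult (fps_nth (A * h ^ k) n) (fps_nth G k))"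
    by (subst sum.swap) (simp add: fps_mult_nth smult_sum)
  finally show ?thesis .
qed

text \<open>
  The umbral substitution \<open>x^k \<mapsto> s2 k\<close> acts on coefficients in \<open>K[x]\<close> only. In the column
  expansion of \<open>A(t) exp (x h(t))\<close> it thus replaces the generating function
  \<open>\<Sum>k. x^k t^k / k!\<close> by that of \<open>s2\<close> and leaves the Riordan array alone.
\<close>

lemma egf_iterated_sheffer:
  assumes h0: "fps_nth h 0 = 0"
    and s1: "fps_lift A * exp_x_times h = egf s1"
  shows "egf (iterated_sheffer s1 s2) = fps_lift A * (egf s2 oo fps_lift h)"
proof (rule fps_ext)
  fix n
  have coeff_s1: "coeff (s1 n) k / fact n = fps_nth (A * h ^ k) n / fact k"
    if "k \<le> n" for k
  proof -
    have "smult (1 / fact n) (s1 n)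
        = (\<Sum>j=0..n. monom (fps_nth (A * h ^ j) n / fact j) j)"
      using arg_cong[OF s1, of "\<lambda>F. fps_nth F n"]
      by (simp add: exp_x_times_eq_egf_compose fps_lift_mult_compose_nth[OF h0]
          smult_monom flip: monom_altdef)
    from arg_cong[OF this, of "\<lambda>p. coeff p k"] show ?thesis
      using that by (simp add: coeff_sum if_distrib cong: if_cong)
  qed
  have "fps_nth (egf (iterated_sheffer s1 s2)) n
      = (\<Sum>k=0..n. smult (coeff (s1 n) k / fact n) (s2 k))"
    by (simp add: iterated_sheffer_def smult_sum_right)
  also have "\<dots> = (\<Sum>k=0..n. smult (fps_nth (A * h ^ k) n) (fps_nth (egf s2) k))"
    by (intro sum.cong) (simp_all add: coeff_s1)
  also have "\<dots> = fps_nth (fps_lift A * (egf s2 oo fps_lift h)) n"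
    by (rule fps_lift_mult_compose_nth[OF h0, symmetric])
  finally show "fps_nth (egf (iterated_sheffer s1 s2)) n
      = fps_nth (fps_lift A * (egf s2 oo fps_lift h)) n" .
qed

theorem theorem2p1:
  fixes g1 g2 f1 f2 :: "'a::field_char_0 fps"
    and s1 s2 :: "nat \<Rightarrow> 'a poly"
  assumes "invertible_series g1" and "invertible_series g2"
    and "delta_series f1" and "delta_series f2"
    and "sheffer_sequence g1 f1 s1" and "sheffer_sequence g2 f2 s2"
  shows "fps_lift (inverse (g1 oo fps_inv f1))
         * fps_lift (inverse (g2 oo (fps_inv f2 oo fps_inv f1)))
         * exp_x_times (fps_inv f2 oo fps_inv f1)
       = egf (iterated_sheffer s1 s2)"
proof -
  define h where "h = fps_inv f1"
  define k where "k = fps_inv f2"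
  have h0: "fps_nth h 0 = 0" and k0: "fps_nth k 0 = 0"
    by (simp_all add: h_def k_def fps_inv_def)
  have s1: "fps_lift (inverse (g1 oo h)) * exp_x_times h = egf s1"
    and s2: "egf s2 = fps_lift (inverse (g2 oo k)) * exp_x_times k"
    using assms(5,6) by (simp_all add: sheffer_sequence_def h_def k_def)
  have "inverse (g2 oo k) oo h = inverse (g2 oo (k oo h))"
    using assms(2) h0 k0
    by (simp add: invertible_series_def fps_inverse_compose fps_compose_assoc)
  then have "egf s2 oo fps_lift h
      = fps_lift (inverse (g2 oo (k oo h))) * exp_x_times (k oo h)"
    using h0 k0
    by (simp add: s2 fps_compose_mult_distrib exp_x_times_compose flip: fps_lift_compose)
  then show ?thesis
    using egf_iterated_sheffer[OF h0 s1] by (simp add: h_def k_def mult.assoc)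
qed

end
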